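(* Let $G=(V,E)$ be a simple undirected unweighted graph, $V=\{1,\dots,n\}$. Then $$1-h^+(G)=\mu_1^+=\min_{\vec x\in\mathbb R^n\setminus\{\vec 0\}}\frac{I^+(\vec x)}{\|\vec x\|},\qquad 1-\widehat h^+(G)=\widehat\mu_1^+=\min_{\vec x\in\mathbb R^n\setminus\{\vec 0\}}\frac{I^+(\vec x)}{I^+(\vec x)+I(\vec x)},$$ where $\mu_1^+$ and $\widehat\mu_1^+$ denote the smallest eigenvalues of the signless 1-Laplacian $\Delta_1^+$ and of the modified signless 1-Laplacian $\widehat\Delta_1^+$, respectively.
   Context: $d_i$ is the degree of vertex $i$, $\mathrm{vol}(S)=\sum_{i\in S}d_i$, $S^c=V\setminus S$, and $E(V_1,V_2)$ is the set of edges with one endpoint in $V_1$ and the other in $V_2$ ($V_1,V_2\subset V$ disjoint). Dual Cheeger constant: $h^+(G)=\max\limits_{V_1\cap V_2=\emptyset,\,V_1\cup V_2\neq\emptyset}\dfrac{2|E(V_1,V_2)|}{\mathrm{vol}(V_1\cup V_2)}$. Modified dual Cheeger constant: $\widehat h^+(G)=\max\limits_{V_1\cap V_2=\emptyset,\,V_1\cup V_2\neq\emptyset}\dfrac{2|E(V_1,V_2)|+|E(V_1\cup V_2,(V_1\cup V_2)^c)|}{\mathrm{vol}(V_1\cup V_2)+|E(V_1\cup V_2,(V_1\cup V_2)^c)|}$. For $\vec x\in\mathbb R^n$: $I(\vec x)=\sum_{\{i,j\}\in E}|x_i-x_j|$, $I^+(\vec x)=\sum_{\{i,j\}\in E}|x_i+x_j|$,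 $\|\vec x\|=\sum_{i\in V}d_i|x_i|$, and $X=\{\vec x\in\mathbb R^n:\|\vec x\|=1\}$. $\partial$ denotes the convex subdifferential; $\Delta_1\vec x=\partial I(\vec x)$, $\Delta_1^+\vec x=\partial I^+(\vec x)$. $\mathrm{Sgn}(t)=\{1\}$ if $t>0$, $\{-1\}$ if $t<0$, $[-1,1]$ if $t=0$, and $D\,\mathrm{Sgn}(\vec x)=\prod_{i=1}^n d_i\mathrm{Sgn}(x_i)=\partial\|\vec x\|$. $(\mu^+,\vec x)\in\mathbb R\times X$ is an eigenpair of $\Delta_1^+$ if $\Delta_1^+\vec x\cap\mu^+D\,\mathrm{Sgn}(\vec x)\ne\emptyset$. $(\widehat\mu^+,\vec x)\in\mathbb R\times X$ is an eigenpair of $\widehat\Delta_1^+$ if $(1-\widehat\mu^+)\Delta_1^+\vec x\cap\widehat\mu^+\Delta_1\vec x\neq\emptyset$. The first entry of an eigenpair is an eigenvalue. *)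

theory Defs
  imports "HOL-Analysis.Analysis"
begin

text \<open>
  A graph on the vertex set \<open>V = UNIV :: 'n set\<close> (a finite type, so that \<open>\<real>\<^sup>n\<close> is
  \<open>real ^ 'n\<close>) is given by its edge set \<open>E\<close>, an edge being a two-element set of vertices.
\<close>

definition simple_graph :: "'n set set \<Rightarrow> bool" where
  "simple_graph E \<longleftrightarrow> (\<forall>e\<in>E. card e = 2)"

definition deg :: "'n set set \<Rightarrow> 'n \<Rightarrow> nat" where
  "deg E i = card {e \<in> E. i \<in> e}"

definition vol :: "'n set set \<Rightarrow> 'n set \<Rightarrow> nat" where
  "vol E S = (\<Sum>i\<in>S. deg E i)"

definition edges_between :: "'n set set \<Rightarrow> 'n set \<Rightarrow> 'n set \<Rightarrow> 'n set set" where
  "edges_between E V1 V2 = {e \<in> E. \<exists>i\<in>V1. \<exists>j\<in>V2. e = {i, j}}"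

text \<open>
  Vertices of degree 0 are allowed, so the denominators below can vanish for nonempty
  \<open>V1 \<union> V2\<close> and for nonzero vectors. All maxima and minima of quotients are taken over the
  arguments for which the quotient is defined; without isolated vertices this is no
  restriction (see the lemmas at the end).
\<close>

definition dual_cheeger :: "'n::finite set set \<Rightarrow> real" where
  "dual_cheeger E =
     Max {2 * real (card (edges_between E V1 V2)) / real (vol E (V1 \<union> V2)) | V1 V2.
            V1 \<inter> V2 = {} \<and> V1 \<union> V2 \<noteq> {} \<and> vol E (V1 \<union> V2) \<noteq> 0}"

definition modified_dual_cheeger :: "'n::finite set set \<Rightarrow> real" where
  "modified_dual_cheeger E =
     Max {(2 * real (card (edges_between E V1 V2))
             + real (card (edges_between E (V1 \<union> V2) (- (V1 \<union> V2)))))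
          / (real (vol E (V1 \<union> V2))
             + real (card (edges_between E (V1 \<union> V2) (- (V1 \<union> V2))))) | V1 V2.
            V1 \<inter> V2 = {} \<and> V1 \<union> V2 \<noteq> {} \<and>
            real (vol E (V1 \<union> V2))
             + real (card (edges_between E (V1 \<union> V2) (- (V1 \<union> V2)))) \<noteq> 0}"

text \<open>
  A sum over edges \<open>{i, j}\<close> is half the sum over the ordered pairs \<open>(i, j)\<close> with
  \<open>{i, j} \<in> E\<close>, since each edge gives rise to exactly two such pairs.
\<close>

definition I_minus :: "'n::finite set set \<Rightarrow> real ^ 'n \<Rightarrow> real" where
  "I_minus E x = (\<Sum>(i, j) | {i, j} \<in> E. \<bar>x $ i - x $ j\<bar>) / 2"

definition I_plus :: "'n::finite set set \<Rightarrow> real ^ 'n \<Rightarrow> real" where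
  "I_plus E x = (\<Sum>(i, j) | {i, j} \<in> E. \<bar>x $ i + x $ j\<bar>) / 2"

definition wnorm :: "'n::finite set set \<Rightarrow> real ^ 'n \<Rightarrow> real" where
  "wnorm E x = (\<Sum>i\<in>UNIV. real (deg E i) * \<bar>x $ i\<bar>)"

definition subdifferential :: "('a::real_inner \<Rightarrow> real) \<Rightarrow> 'a \<Rightarrow> 'a set" where
  "subdifferential f x = {v. \<forall>y. f x + v \<bullet> (y - x) \<le> f y}"

definition laplacian1 :: "'n::finite set set \<Rightarrow> real ^ 'n \<Rightarrow> (real ^ 'n) set" where
  "laplacian1 E x = subdifferential (I_minus E) x"

definition signless_laplacian1 :: "'n::finite set set \<Rightarrow> real ^ 'n \<Rightarrow> (real ^ 'n) set" where
  "signless_laplacian1 E x = subdifferential (I_plus E) x"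

definition Sgn :: "real \<Rightarrow> real set" where
  "Sgn t = (if t > 0 then {1} else if t < 0 then {-1} else {-1..1})"

definition DSgn :: "'n::finite set set \<Rightarrow> real ^ 'n \<Rightarrow> (real ^ 'n) set" where
  "DSgn E x = {v. \<forall>i. v $ i \<in> (\<lambda>s. real (deg E i) * s) ` Sgn (x $ i)}"

definition signless_eigenpair :: "'n::finite set set \<Rightarrow> real \<Rightarrow> real ^ 'n \<Rightarrow> bool" where
  "signless_eigenpair E \<mu> x \<longleftrightarrow>
     wnorm E x = 1 \<and> signless_laplacian1 E x \<inter> (\<lambda>v. \<mu> *\<^sub>R v) ` DSgn E x \<noteq> {}"

definition modified_signless_eigenpair :: "'n::finite set set \<Rightarrow> real \<Rightarrow> real ^ 'n \<Rightarrow> bool" where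
  "modified_signless_eigenpair E \<mu> x \<longleftrightarrow>
     wnorm E x = 1 \<and>
     (\<lambda>v. (1 - \<mu>) *\<^sub>R v) ` signless_laplacian1 E x \<inter> (\<lambda>v. \<mu> *\<^sub>R v) ` laplacian1 E x \<noteq> {}"

definition signless_eigenvalue :: "'n::finite set set \<Rightarrow> real \<Rightarrow> bool" where
  "signless_eigenvalue E \<mu> \<longleftrightarrow> (\<exists>x. signless_eigenpair E \<mu> x)"

definition modified_signless_eigenvalue :: "'n::finite set set \<Rightarrow> real \<Rightarrow> bool" where
  "modified_signless_eigenvalue E \<mu> \<longleftrightarrow> (\<exists>x. modified_signless_eigenpair E \<mu> x)"

definition is_minimum :: "real set \<Rightarrow> real \<Rightarrow> bool" where
  "is_minimum S m \<longleftrightarrow> m \<in> S \<and> (\<forall>s\<in>S. m \<le> s)"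

lemma vol_nonzero:
  fixes E :: "'n::finite set set"
  assumes "\<And>i. deg E i > 0" and "S \<noteq> {}"
  shows "vol E S \<noteq> 0"
proof
  assume "vol E S = 0"
  then have "\<forall>i\<in>S. deg E i = 0" by (simp add: vol_def)
  moreover from assms(2) obtain i where "i \<in> S" by blast
  ultimately show False using assms(1)[of i] by simp
qed

lemma wnorm_nonzero:
  fixes E :: "'n::finite set set"
  assumes "\<And>i. deg E i > 0" and "x \<noteq> 0"
  shows "wnorm E x \<noteq> 0"
proof
  assume "wnorm E x = 0"
  then have "\<forall>i\<in>UNIV. real (deg E i) * \<bar>x $ i\<bar> = 0"
    unfolding wnorm_def by (subst (asm) sum_nonneg_eq_0_iff) auto
  then have "x $ i = 0" for i using assms(1)[of i] by (auto dest: spec[of _ i])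
  then have "x = 0" by (simp add: vec_eq_iff)
  with assms(2) show False ..
qed

lemma I_plus_I_minus_nonzero:
  fixes E :: "'n::finite set set"
  assumes "simple_graph E" and "\<And>i. deg E i > 0" and "x \<noteq> 0"
  shows "I_plus E x + I_minus E x \<noteq> 0"
proof
  assume "I_plus E x + I_minus E x = 0"
  then have "(\<Sum>(i, j) | {i, j} \<in> E. \<bar>x $ i + x $ j\<bar> + \<bar>x $ i - x $ j\<bar>) = 0"
    by (simp add: I_plus_def I_minus_def case_prod_unfold sum.distrib)
  then have "\<forall>p\<in>{(i, j). {i, j} \<in> E}.
      (case p of (i, j) \<Rightarrow> \<bar>x $ i + x $ j\<bar> + \<bar>x $ i - x $ j\<bar>) = 0"
    by (subst (asm) sum_nonneg_eq_0_iff) auto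
  then have *: "\<bar>x $ i + x $ j\<bar> + \<bar>x $ i - x $ j\<bar> = 0" if "{i, j} \<in> E" for i j
    using that by (auto dest: bspec[of _ _ "(i, j)"])
  have "x $ i = 0" for i
  proof -
    have "{e \<in> E. i \<in> e} \<noteq> {}"
      using assms(2)[of i] by (metis deg_def card.empty less_irrefl)
    then obtain e where e: "e \<in> E" "i \<in> e" by blast
    then have "card e = 2" using assms(1) by (simp add: simple_graph_def)
    then obtain j where "e = {i, j}" using e(2) by (auto simp: card_2_iff)
    then show ?thesis using *[of i j] e(1) by auto
  qed
  with assms(3) show False by (simp add: vec_eq_iff)
qed

end

theory Submission
  imports Defs
begin

text \<open>
  Both halves have the same proof, with \<open>N = I_plus E\<close> over \<open>D = wnorm E\<close> in the first and
  \<open>N = I_plus E\<close> over \<open>D = I_plus E + I_minus E\<close> in the second.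

  Cheeger quotients are Rayleigh quotients: a disjoint pair \<open>V1\<close>, \<open>V2\<close> is the same thing as
  the sign vector \<open>s\<close> equal to \<open>1\<close> on \<open>V1\<close>, to \<open>-1\<close> on \<open>V2\<close> and to \<open>0\<close> elsewhere. An edge
  contributes to \<open>D s - N s\<close> only if it joins \<open>V1\<close> to \<open>V2\<close>, where \<open>\<bar>s i + s j\<bar>\<close> cancels, or, in
  the second case, if it leaves \<open>V1 \<union> V2\<close>. Counting gives that the Cheeger quotient of the
  pair is \<open>1 - N s / D s\<close>, so \<open>1 - h\<close> is the minimum of \<open>N / D\<close> over sign vectors.

  Sign vectors suffice: let \<open>t\<close> be the smallest nonzero value of \<open>\<bar>x i\<bar>\<close> and \<open>s\<close> the vector of
  signs of \<open>x\<close>. Replacing \<open>x\<close> by \<open>x - t s\<close> shrinks the support, and every function used here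
  satisfies \<open>f x = f (x - t s) + t f s\<close>. So an inequality \<open>m D \<le> N\<close> on sign vectors passes to all
  vectors by peeling off layers (\<open>layer_induct\<close>, \<open>layer_additive_bound\<close>). This is a discrete
  coarea formula. Since there are finitely many sign vectors, the minimum is attained.

  The minimum is the least eigenvalue: all functions are positively homogeneous, so a
  subgradient \<open>v\<close> of \<open>f\<close> at \<open>x\<close> satisfies \<open>v \<bullet> x = f x\<close>. Pairing the eigenvalue inclusion with
  \<open>x\<close> shows that each eigenvalue is a value of the quotient. Conversely, if \<open>c g \<le> f\<close> with
  equality at \<open>x\<close>, then \<open>c v\<close> is a subgradient of \<open>f\<close> at \<open>x\<close> for every subgradient \<open>v\<close> of
  \<open>g\<close> (\<open>scaled_subgradient_at_minimiser\<close>). At a minimiser this produces an element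
  of the required intersection. In the modified case it is applied with \<open>c = m / (1 - m)\<close>, which makes sense since an edge forces
  \<open>m < 1\<close>.
\<close>

section \<open>Sums over ordered pairs of adjacent vertices\<close>

definition arcs :: "'n set set \<Rightarrow> ('n \<times> 'n) set" where
  "arcs E = {(i, j). {i, j} \<in> E}"

lemma sum_arcs_swap:
  "(\<Sum>(i, j)\<in>arcs E. f j i) = (\<Sum>(i, j)\<in>arcs E. f i j)"
  by (rule sum.reindex_bij_witness[of _ prod.swap prod.swap])
     (auto simp: arcs_def insert_commute)

lemma arc_endpoints_distinct:
  assumes "simple_graph E" and "{i, j} \<in> E"
  shows "i \<noteq> j"
  using assms by (auto simp: simple_graph_def dest!: bspec)

lemma deg_eq_card_neighbours:
  fixes E :: "'n::finite set set"
  assumes "simple_graph E"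
  shows "deg E i = card {j. {i, j} \<in> E}"
proof -
  have "inj_on (\<lambda>j. {i, j}) {j. {i, j} \<in> E}"
    by (auto simp: inj_on_def doubleton_eq_iff)
  moreover have "(\<lambda>j. {i, j}) ` {j. {i, j} \<in> E} = {e \<in> E. i \<in> e}"
  proof (intro equalityI subsetI)
    fix e assume e: "e \<in> {e \<in> E. i \<in> e}"
    then have "card e = 2" using assms by (simp add: simple_graph_def)
    with e obtain j where "e = {i, j}" by (auto simp: card_2_iff)
    with e show "e \<in> (\<lambda>j. {i, j}) ` {j. {i, j} \<in> E}" by auto
  qed auto
  ultimately show ?thesis
    unfolding deg_def using card_image by fastforce
qed

lemma sum_deg_eq_sum_arcs:
  fixes E :: "'n::finite set set" and f :: "'n \<Rightarrow> real"
  assumes "simple_graph E"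
  shows "(\<Sum>i\<in>UNIV. real (deg E i) * f i) = (\<Sum>(i, j)\<in>arcs E. f i)"
proof -
  have "arcs E = Sigma UNIV (\<lambda>i. {j. {i, j} \<in> E})"
    by (auto simp: arcs_def)
  then have "(\<Sum>(i, j)\<in>arcs E. f i) = (\<Sum>i\<in>UNIV. \<Sum>j\<in>{j. {i, j} \<in> E}. f i)"
    by (simp only:) (subst sum.Sigma, simp_all)
  then show ?thesis
    by (simp add: deg_eq_card_neighbours[OF assms])
qed

lemma wnorm_eq_sum_arcs:
  fixes E :: "'n::finite set set"
  assumes "simple_graph E"
  shows "wnorm E x = (\<Sum>(i, j)\<in>arcs E. \<bar>x $ i\<bar> + \<bar>x $ j\<bar>) / 2"
proof -
  have "wnorm E x = (\<Sum>(i, j)\<in>arcs E. \<bar>x $ i\<bar>)"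
    unfolding wnorm_def by (rule sum_deg_eq_sum_arcs[OF assms])
  moreover have "(\<Sum>(i, j)\<in>arcs E. \<bar>x $ j\<bar>) = (\<Sum>(i, j)\<in>arcs E. \<bar>x $ i\<bar>)"
    by (rule sum_arcs_swap)
  ultimately show ?thesis
    by (simp add: case_prod_unfold sum.distrib)
qed

text \<open>
  Disjointness makes the orientation of an edge between the two sets unique, so that each such
  edge is hit by exactly one arc from \<open>A\<close> to \<open>B\<close> and one arc from \<open>B\<close> to \<open>A\<close>.
\<close>

lemma card_edges_between_eq_sum_arcs:
  fixes E :: "'n::finite set set"
  assumes "A \<inter> B = {}"
  shows "2 * real (card (edges_between E A B)) =
    (\<Sum>(i, j)\<in>arcs E. of_bool (i \<in> A \<and> j \<in> B) + of_bool (j \<in> A \<and> i \<in> B))"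
proof -
  let ?P = "{(i, j) \<in> arcs E. i \<in> A \<and> j \<in> B}"
  have "inj_on (\<lambda>(i, j). {i, j}) ?P"
    using assms by (auto simp: inj_on_def doubleton_eq_iff)
  moreover have "(\<lambda>(i, j). {i, j}) ` ?P = edges_between E A B"
    by (auto simp: edges_between_def arcs_def image_iff)
  ultimately have "card (edges_between E A B) = card ?P"
    using card_image by fastforce
  moreover have "real (card ?P) = (\<Sum>(i, j)\<in>arcs E. of_bool (i \<in> A \<and> j \<in> B))"
  proof -
    have "?P = arcs E \<inter> {p. fst p \<in> A \<and> snd p \<in> B}" by auto
    then show ?thesis
      by (simp only: case_prod_unfold) (subst sum_of_bool_eq, simp_all)
  qed
  moreover have "(\<Sum>(i, j)\<in>arcs E. of_bool (j \<in> A \<and> i \<in> B)) =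
      (\<Sum>(i, j)\<in>arcs E. of_bool (i \<in> A \<and> j \<in> B) :: real)"
    by (rule sum_arcs_swap)
  ultimately show ?thesis
    by (simp add: case_prod_unfold sum.distrib)
qed

lemma I_plus_eq_sum_arcs: "I_plus E x = (\<Sum>(i, j)\<in>arcs E. \<bar>x $ i + x $ j\<bar>) / 2"
  by (simp add: I_plus_def arcs_def)

lemma I_minus_eq_sum_arcs: "I_minus E x = (\<Sum>(i, j)\<in>arcs E. \<bar>x $ i - x $ j\<bar>) / 2"
  by (simp add: I_minus_def arcs_def)

lemma I_plus_nonneg: "I_plus E x \<ge> 0"
  by (auto simp: I_plus_def intro!: sum_nonneg)

lemma I_minus_nonneg: "I_minus E x \<ge> 0"
  by (auto simp: I_minus_def intro!: sum_nonneg)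

lemma wnorm_nonneg: "wnorm E x \<ge> 0"
  by (auto simp: wnorm_def intro!: sum_nonneg)

text \<open>
  On each arc \<open>\<bar>a + b\<bar> + \<bar>a - b\<bar> = 2 max \<bar>a\<bar> \<bar>b\<bar>\<close>, which lies between \<open>\<bar>a\<bar> + \<bar>b\<bar>\<close> and
  twice that. Together with the next lemma this says that the two denominators vanish at the
  same vectors.
\<close>

lemma wnorm_le_I_plus_I_minus:
  fixes E :: "'n::finite set set"
  assumes "simple_graph E"
  shows "wnorm E x \<le> I_plus E x + I_minus E x"
proof -
  have "(\<Sum>(i, j)\<in>arcs E. \<bar>x $ i\<bar> + \<bar>x $ j\<bar>) \<le>
      (\<Sum>(i, j)\<in>arcs E. \<bar>x $ i + x $ j\<bar> + \<bar>x $ i - x $ j\<bar>)"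
    by (intro sum_mono) auto
  then show ?thesis
    by (simp add: wnorm_eq_sum_arcs[OF assms] I_plus_eq_sum_arcs I_minus_eq_sum_arcs
        case_prod_unfold sum.distrib)
qed

lemma I_plus_I_minus_le_wnorm:
  fixes E :: "'n::finite set set"
  assumes "simple_graph E"
  shows "I_plus E x + I_minus E x \<le> 2 * wnorm E x"
proof -
  have "(\<Sum>(i, j)\<in>arcs E. \<bar>x $ i + x $ j\<bar> + \<bar>x $ i - x $ j\<bar>) \<le>
      (\<Sum>(i, j)\<in>arcs E. 2 * (\<bar>x $ i\<bar> + \<bar>x $ j\<bar>))"
    by (intro sum_mono) auto
  also have "\<dots> = 2 * (\<Sum>(i, j)\<in>arcs E. \<bar>x $ i\<bar> + \<bar>x $ j\<bar>)"
    by (simp only: case_prod_unfold sum_distrib_left)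
  finally show ?thesis
    by (simp add: wnorm_eq_sum_arcs[OF assms] I_plus_eq_sum_arcs I_minus_eq_sum_arcs
        case_prod_unfold sum.distrib)
qed

lemma I_minus_axis_pos:
  fixes E :: "'n::finite set set"
  assumes "simple_graph E" and "{i, j} \<in> E"
  shows "I_minus E (axis i 1) > 0"
proof -
  have "i \<noteq> j" using arc_endpoints_distinct[OF assms] .
  then have "(\<Sum>(k, l)\<in>arcs E. \<bar>axis i 1 $ k - axis i 1 $ l\<bar> :: real) > 0"
    using assms(2) by (intro sum_pos2[of _ "(i, j)"]) (auto simp: arcs_def axis_def)
  then show ?thesis by (simp add: I_minus_eq_sum_arcs)
qed

section \<open>Sign vectors and layers\<close>

definition sign_vec :: "'n::finite set \<Rightarrow> 'n set \<Rightarrow> real ^ 'n" where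
  "sign_vec V1 V2 = (\<chi> i. if i \<in> V1 then 1 else if i \<in> V2 then - 1 else 0)"

text \<open>
  Additivity is demanded only along sign vectors that do not contradict the signs of \<open>x\<close>. This is
  enough to peel off layers, and it holds for \<open>\<bar>x i + x j\<bar>\<close> and \<open>\<bar>x i - x j\<bar>\<close>
  although these are not additive in general. The sets may be larger than the positive and
  negative parts of \<open>x\<close>, because the layers next to the origin have the widest support.
\<close>

definition layer_additive :: "(real ^ 'n::finite \<Rightarrow> real) \<Rightarrow> bool" where
  "layer_additive f \<longleftrightarrow>
     (\<forall>x V1 V2 t. t \<ge> 0 \<longrightarrow> V1 \<inter> V2 = {} \<longrightarrow> {i. x $ i > 0} \<subseteq> V1 \<longrightarrow> {i. x $ i < 0} \<subseteq> V2 \<longrightarrow>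
        f (x + t *\<^sub>R sign_vec V1 V2) = f x + t * f (sign_vec V1 V2))"

text \<open>
  Subtracting the smallest nonzero absolute value from all nonzero absolute values
  kills at least one coordinate and reverses no sign; induction is on the size of the support.
\<close>

lemma layer_induct:
  fixes x :: "real ^ 'n::finite"
  assumes zero: "P 0"
    and layer: "\<And>x V1 V2 t. P x \<Longrightarrow> t \<ge> 0 \<Longrightarrow> V1 \<inter> V2 = {} \<Longrightarrow>
      {i. x $ i > 0} \<subseteq> V1 \<Longrightarrow> {i. x $ i < 0} \<subseteq> V2 \<Longrightarrow> P (x + t *\<^sub>R sign_vec V1 V2)"
  shows "P x"
proof (induction "card {i. x $ i \<noteq> 0}" arbitrary: x rule: less_induct)
  case less
  show ?case
  proof (cases "x = 0")
    case True
    with zero show ?thesis by simp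
  next
    case False
    define S where "S = {i. x $ i \<noteq> 0}"
    define t where "t = Min ((\<lambda>i. \<bar>x $ i\<bar>) ` S)"
    define s where "s = sign_vec {i. x $ i > 0} {i. x $ i < 0}"
    have "S \<noteq> {}" using False by (auto simp: S_def vec_eq_iff)
    then have "t \<in> (\<lambda>i. \<bar>x $ i\<bar>) ` S" unfolding t_def by (intro Min_in) auto
    then obtain k where k: "k \<in> S" "t = \<bar>x $ k\<bar>" by auto
    have t: "t \<ge> 0" using k by simp
    have t_le: "t \<le> \<bar>x $ i\<bar>" if "x $ i \<noteq> 0" for i
      using that by (auto simp: t_def S_def intro!: Min_le)
    have diff: "(x - t *\<^sub>R s) $ i = (if x $ i > 0 then x $ i - t else if x $ i < 0 then x $ i + t else 0)"
      for i by (simp add: s_def sign_vec_def)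
    have "(x - t *\<^sub>R s) $ k = 0" unfolding diff using k by (simp add: S_def)
    moreover have "(x - t *\<^sub>R s) $ i = 0" if "i \<notin> S" for i
      unfolding diff using that by (simp add: S_def)
    ultimately have "{i. (x - t *\<^sub>R s) $ i \<noteq> 0} \<subseteq> S - {k}" by blast
    with k(1) have "card {i. (x - t *\<^sub>R s) $ i \<noteq> 0} < card {i. x $ i \<noteq> 0}"
      unfolding S_def by (intro psubset_card_mono) auto
    then have "P (x - t *\<^sub>R s)" by (rule less)
    moreover have "((x - t *\<^sub>R s) $ i > 0 \<longrightarrow> x $ i > 0) \<and> ((x - t *\<^sub>R s) $ i < 0 \<longrightarrow> x $ i < 0)" for i
      unfolding diff using t_le[of i] by auto
    ultimately have "P (x - t *\<^sub>R s + t *\<^sub>R sign_vec {i. x $ i > 0} {i. x $ i < 0})"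
      using t by (intro layer) auto
    then show ?thesis by (simp add: s_def)
  qed
qed

text \<open>
  If both endpoints carry signs that agree, the absolute value is linear; if they are
  opposite, the two summands of the layer cancel; if one coordinate of the sign vector is \<open>0\<close>, so is
  that coordinate of \<open>x\<close>.
\<close>

lemma layer_additive_I_plus: "layer_additive (I_plus E)"
proof -
  have *: "\<bar>(x + t *\<^sub>R sign_vec V1 V2) $ i + (x + t *\<^sub>R sign_vec V1 V2) $ j\<bar>
      = \<bar>x $ i + x $ j\<bar> + t * \<bar>sign_vec V1 V2 $ i + sign_vec V1 V2 $ j\<bar>"
    if "t \<ge> 0" "V1 \<inter> V2 = {}" "{i. x $ i > 0} \<subseteq> V1" "{i. x $ i < 0} \<subseteq> V2"
    for x :: "real ^ 'n" and t V1 V2 i j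
  proof -
    have "i \<in> V1 \<or> x $ i \<le> 0" "i \<in> V2 \<or> x $ i \<ge> 0" "j \<in> V1 \<or> x $ j \<le> 0" "j \<in> V2 \<or> x $ j \<ge> 0"
      "\<not> (i \<in> V1 \<and> i \<in> V2)" "\<not> (j \<in> V1 \<and> j \<in> V2)"
      using that by force+
    with \<open>t \<ge> 0\<close> show ?thesis by (auto simp: sign_vec_def)
  qed
  show ?thesis
    unfolding layer_additive_def I_plus_eq_sum_arcs
    by (auto simp: * case_prod_unfold sum.distrib sum_distrib_left field_simps
        simp del: vector_add_component)
qed

lemma layer_additive_I_minus: "layer_additive (I_minus E)"
proof -
  have *: "\<bar>(x + t *\<^sub>R sign_vec V1 V2) $ i - (x + t *\<^sub>R sign_vec V1 V2) $ j\<bar>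
      = \<bar>x $ i - x $ j\<bar> + t * \<bar>sign_vec V1 V2 $ i - sign_vec V1 V2 $ j\<bar>"
    if "t \<ge> 0" "V1 \<inter> V2 = {}" "{i. x $ i > 0} \<subseteq> V1" "{i. x $ i < 0} \<subseteq> V2"
    for x :: "real ^ 'n" and t V1 V2 i j
  proof -
    have "i \<in> V1 \<or> x $ i \<le> 0" "i \<in> V2 \<or> x $ i \<ge> 0" "j \<in> V1 \<or> x $ j \<le> 0" "j \<in> V2 \<or> x $ j \<ge> 0"
      "\<not> (i \<in> V1 \<and> i \<in> V2)" "\<not> (j \<in> V1 \<and> j \<in> V2)"
      using that by force+
    with \<open>t \<ge> 0\<close> show ?thesis by (auto simp: sign_vec_def)
  qed
  show ?thesis
    unfolding layer_additive_def I_minus_eq_sum_arcs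
    by (auto simp: * case_prod_unfold sum.distrib sum_distrib_left field_simps
        simp del: vector_add_component)
qed

lemma layer_additive_wnorm: "layer_additive (wnorm E)"
proof -
  have *: "\<bar>(x + t *\<^sub>R sign_vec V1 V2) $ i\<bar> = \<bar>x $ i\<bar> + t * \<bar>sign_vec V1 V2 $ i\<bar>"
    if "t \<ge> 0" "V1 \<inter> V2 = {}" "{i. x $ i > 0} \<subseteq> V1" "{i. x $ i < 0} \<subseteq> V2"
    for x :: "real ^ 'n" and t V1 V2 i
  proof -
    have "i \<in> V1 \<or> x $ i \<le> 0" "i \<in> V2 \<or> x $ i \<ge> 0" "\<not> (i \<in> V1 \<and> i \<in> V2)"
      using that by force+
    with \<open>t \<ge> 0\<close> show ?thesis by (auto simp: sign_vec_def)
  qed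
  show ?thesis
    unfolding layer_additive_def wnorm_def
    by (auto simp: * sum.distrib sum_distrib_left field_simps simp del: vector_add_component)
qed

lemma layer_additive_add:
  "layer_additive f \<Longrightarrow> layer_additive g \<Longrightarrow> layer_additive (\<lambda>x. f x + g x)"
  by (simp add: layer_additive_def algebra_simps)

lemma layer_additive_bound:
  assumes "layer_additive N" "layer_additive D" "N 0 = 0" "D 0 = 0"
    and "\<And>V1 V2. V1 \<inter> V2 = {} \<Longrightarrow> m * D (sign_vec V1 V2) \<le> N (sign_vec V1 V2)"
  shows "m * D x \<le> N x"
proof (induction x rule: layer_induct)
  case 1
  then show ?case using assms by simp
next
  case (2 x V1 V2 t)
  have "t * (m * D (sign_vec V1 V2)) \<le> t * N (sign_vec V1 V2)"
    using 2 assms(5) by (intro mult_left_mono) auto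
  moreover have "N (x + t *\<^sub>R sign_vec V1 V2) = N x + t * N (sign_vec V1 V2)"
    "D (x + t *\<^sub>R sign_vec V1 V2) = D x + t * D (sign_vec V1 V2)"
    using assms(1,2) 2 by (auto simp: layer_additive_def)
  ultimately show ?case using 2(1) by (simp add: algebra_simps)
qed

text \<open>
  The common shape of the two identities between a Cheeger constant \<open>Max R\<close> and a minimal Rayleigh
  quotient \<open>N / D\<close>. There are finitely many sign vectors, so one of them attains the minimum.
\<close>

lemma is_minimum_quotient_of_cheeger:
  fixes N D :: "real ^ 'n::finite \<Rightarrow> real" and R :: "'n set \<Rightarrow> 'n set \<Rightarrow> real"
  assumes additive: "layer_additive N" "layer_additive D"
    and zero: "N 0 = 0" "D 0 = 0" and nonneg: "\<And>x. N x \<ge> 0" "\<And>x. D x \<ge> 0"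
    and ratio: "\<And>V1 V2. V1 \<inter> V2 = {} \<Longrightarrow> D (sign_vec V1 V2) \<noteq> 0 \<Longrightarrow>
      R V1 V2 = 1 - N (sign_vec V1 V2) / D (sign_vec V1 V2)"
    and nontrivial: "D (sign_vec UNIV {}) \<noteq> 0"
  shows "is_minimum {N x / D x | x. x \<noteq> 0 \<and> D x \<noteq> 0}
    (1 - Max {R V1 V2 | V1 V2. V1 \<inter> V2 = {} \<and> V1 \<union> V2 \<noteq> {} \<and> D (sign_vec V1 V2) \<noteq> 0})"
    (is "is_minimum ?Q (1 - Max ?R)")
proof -
  have "?R \<subseteq> (\<lambda>(V1, V2). R V1 V2) ` UNIV" by auto
  then have fin: "finite ?R" by (rule finite_subset) simp
  have "R UNIV {} \<in> ?R" using nontrivial by blast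
  then have "Max ?R \<in> ?R" using fin by (intro Max_in) auto
  then obtain V1 V2 where V: "V1 \<inter> V2 = {}" "D (sign_vec V1 V2) \<noteq> 0" "Max ?R = R V1 V2"
    by auto
  have attained: "1 - Max ?R \<in> ?Q"
  proof -
    have "sign_vec V1 V2 \<noteq> 0" using V(2) zero by auto
    moreover have "1 - Max ?R = N (sign_vec V1 V2) / D (sign_vec V1 V2)"
      using ratio V by simp
    ultimately show ?thesis using V by blast
  qed
  have sign: "(1 - Max ?R) * D (sign_vec U1 U2) \<le> N (sign_vec U1 U2)" if "U1 \<inter> U2 = {}" for U1 U2
  proof (cases "D (sign_vec U1 U2) = 0")
    case True
    then show ?thesis using nonneg by simp
  next
    case False
    have "sign_vec {} {} = (0 :: real ^ 'n)" by (simp add: sign_vec_def vec_eq_iff)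
    with zero have "D (sign_vec {} {}) = 0" by simp
    with False have "U1 \<union> U2 \<noteq> {}" by auto
    with False that have "R U1 U2 \<in> ?R" by blast
    with fin have "R U1 U2 \<le> Max ?R" by simp
    then have "1 - Max ?R \<le> N (sign_vec U1 U2) / D (sign_vec U1 U2)"
      using ratio[OF that False] by simp
    moreover have "D (sign_vec U1 U2) > 0" using False nonneg(2) by (simp add: less_le)
    ultimately show ?thesis by (simp add: pos_le_divide_eq)
  qed
  have "1 - Max ?R \<le> N x / D x" if "D x \<noteq> 0" for x
  proof -
    have "D x > 0" using that nonneg(2) by (simp add: less_le)
    then show ?thesis
      using layer_additive_bound[OF additive zero sign, of x] by (simp add: pos_le_divide_eq)
  qed
  then have "\<forall>q\<in>?Q. 1 - Max ?R \<le> q" by auto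
  with attained show ?thesis unfolding is_minimum_def by (rule conjI)
qed

section \<open>Cheeger quotients as Rayleigh quotients of sign vectors\<close>

lemma wnorm_sign_vec:
  assumes "V1 \<inter> V2 = {}"
  shows "wnorm E (sign_vec V1 V2) = real (vol E (V1 \<union> V2))"
proof -
  have "wnorm E (sign_vec V1 V2) = (\<Sum>i\<in>UNIV. if i \<in> V1 \<union> V2 then real (deg E i) else 0)"
    unfolding wnorm_def by (intro sum.cong) (auto simp: sign_vec_def)
  also have "\<dots> = (\<Sum>i\<in>V1 \<union> V2. real (deg E i))"
    by (rule sum.mono_neutral_cong_right) auto
  finally show ?thesis by (simp add: vol_def)
qed

text \<open>
  On an arc, \<open>\<bar>s i\<bar> + \<bar>s j\<bar>\<close> exceeds \<open>\<bar>s i + s j\<bar>\<close> by \<open>2\<close> if its endpoints have opposite signs,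
  and by nothing otherwise.
\<close>

lemma I_plus_sign_vec:
  fixes E :: "'n::finite set set"
  assumes "simple_graph E" and "V1 \<inter> V2 = {}"
  shows "I_plus E (sign_vec V1 V2) =
    real (vol E (V1 \<union> V2)) - 2 * real (card (edges_between E V1 V2))"
proof -
  let ?s = "sign_vec V1 V2"
  have "(\<Sum>(i, j)\<in>arcs E. \<bar>?s $ i\<bar> + \<bar>?s $ j\<bar>) =
     (\<Sum>(i, j)\<in>arcs E. \<bar>?s $ i + ?s $ j\<bar>
        + 2 * (of_bool (i \<in> V1 \<and> j \<in> V2) + of_bool (j \<in> V1 \<and> i \<in> V2)))"
    using assms(2) by (intro sum.cong) (auto simp: sign_vec_def)
  also have "\<dots> = (\<Sum>(i, j)\<in>arcs E. \<bar>?s $ i + ?s $ j\<bar>)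
     + 2 * (\<Sum>(i, j)\<in>arcs E. of_bool (i \<in> V1 \<and> j \<in> V2) + of_bool (j \<in> V1 \<and> i \<in> V2))"
    by (simp add: case_prod_unfold sum.distrib flip: sum_distrib_left)
  also have "\<dots> = (\<Sum>(i, j)\<in>arcs E. \<bar>?s $ i + ?s $ j\<bar>) + 4 * real (card (edges_between E V1 V2))"
    by (simp add: card_edges_between_eq_sum_arcs[OF assms(2), symmetric])
  finally show ?thesis
    using wnorm_sign_vec[OF assms(2), of E]
    by (simp add: wnorm_eq_sum_arcs[OF assms(1)] I_plus_eq_sum_arcs)
qed

text \<open>
  On an arc, \<open>\<bar>s i + s j\<bar> + \<bar>s i - s j\<bar>\<close> is \<open>2\<close> as soon as one endpoint has a nonzero sign, while
  \<open>\<bar>s i\<bar> + \<bar>s j\<bar>\<close> is then only \<open>1\<close> if the other endpoint lies outside. The excess therefore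
  counts the boundary.
\<close>

lemma I_plus_I_minus_sign_vec:
  fixes E :: "'n::finite set set"
  assumes "simple_graph E" and "V1 \<inter> V2 = {}"
  shows "I_plus E (sign_vec V1 V2) + I_minus E (sign_vec V1 V2) =
    real (vol E (V1 \<union> V2)) + real (card (edges_between E (V1 \<union> V2) (- (V1 \<union> V2))))"
proof -
  let ?s = "sign_vec V1 V2" and ?W = "V1 \<union> V2"
  have "(\<Sum>(i, j)\<in>arcs E. \<bar>?s $ i + ?s $ j\<bar> + \<bar>?s $ i - ?s $ j\<bar>) =
     (\<Sum>(i, j)\<in>arcs E. (\<bar>?s $ i\<bar> + \<bar>?s $ j\<bar>)
        + (of_bool (i \<in> ?W \<and> j \<in> - ?W) + of_bool (j \<in> ?W \<and> i \<in> - ?W)))"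
    using assms(2) by (intro sum.cong) (auto simp: sign_vec_def)
  also have "\<dots> = (\<Sum>(i, j)\<in>arcs E. \<bar>?s $ i\<bar> + \<bar>?s $ j\<bar>)
     + (\<Sum>(i, j)\<in>arcs E. of_bool (i \<in> ?W \<and> j \<in> - ?W) + of_bool (j \<in> ?W \<and> i \<in> - ?W))"
    by (simp only: case_prod_unfold sum.distrib)
  also have "\<dots> = (\<Sum>(i, j)\<in>arcs E. \<bar>?s $ i\<bar> + \<bar>?s $ j\<bar>) + 2 * real (card (edges_between E ?W (- ?W)))"
    by (subst card_edges_between_eq_sum_arcs[of ?W "- ?W"]) auto
  finally show ?thesis
    using wnorm_sign_vec[OF assms(2), of E]
    by (simp add: wnorm_eq_sum_arcs[OF assms(1)] I_plus_eq_sum_arcs I_minus_eq_sum_arcs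
        case_prod_unfold sum.distrib add_divide_distrib)
qed

section \<open>Subgradients of positively homogeneous functions\<close>

definition pos_homogeneous :: "('a::real_vector \<Rightarrow> real) \<Rightarrow> bool" where
  "pos_homogeneous f \<longleftrightarrow> (\<forall>c x. c \<ge> 0 \<longrightarrow> f (c *\<^sub>R x) = c * f x)"

lemma pos_homogeneous_zero: "pos_homogeneous f \<Longrightarrow> f 0 = 0"
  unfolding pos_homogeneous_def by (metis mult_zero_left order_refl scaleR_zero_left)

lemma pos_homogeneous_I_plus: "pos_homogeneous (I_plus E)"
  by (auto simp: pos_homogeneous_def I_plus_def sum_distrib_left case_prod_unfold abs_mult
      simp flip: distrib_left)

lemma pos_homogeneous_I_minus: "pos_homogeneous (I_minus E)"
  by (auto simp: pos_homogeneous_def I_minus_def sum_distrib_left case_prod_unfold abs_mult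
      simp flip: right_diff_distrib)

lemma pos_homogeneous_wnorm: "pos_homogeneous (wnorm E)"
  by (auto simp: pos_homogeneous_def wnorm_def sum_distrib_left abs_mult algebra_simps)

text \<open>
  Testing the subgradient inequality at \<open>0\<close> and at \<open>2 x\<close> gives the two halves of \<open>v \<bullet> x = f x\<close>.
\<close>

lemma subdifferential_pos_homogeneous:
  fixes f :: "'a::real_inner \<Rightarrow> real"
  assumes "pos_homogeneous f"
  shows "subdifferential f x = {v. v \<bullet> x = f x \<and> (\<forall>y. v \<bullet> y \<le> f y)}"
proof (intro equalityI subsetI; clarsimp simp: subdifferential_def inner_diff_right)
  fix v assume v: "\<forall>y. f x + (v \<bullet> y - v \<bullet> x) \<le> f y"
  have "f x + (v \<bullet> (2 *\<^sub>R x) - v \<bullet> x) \<le> f (2 *\<^sub>R x)" using v by blast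
  moreover have "f (2 *\<^sub>R x) = 2 * f x" using assms by (simp add: pos_homogeneous_def)
  ultimately have "v \<bullet> x \<le> f x" by simp
  moreover have "f x \<le> v \<bullet> x"
    using spec[OF v, of 0] pos_homogeneous_zero[OF assms] by simp
  ultimately show "v \<bullet> x = f x \<and> (\<forall>y. v \<bullet> y \<le> f y)"
    using v by auto
qed

text \<open>
  The chain \<open>c (v \<bullet> y) \<le> c g y \<le> f y\<close> is an equality at \<open>y = x\<close>. This produces
  eigenvectors: minimisers of a quotient \<open>f / g\<close> are critical for every choice
  of the subgradient of \<open>g\<close>.
\<close>

lemma scaled_subgradient_at_minimiser:
  fixes f g :: "'a::real_inner \<Rightarrow> real"
  assumes "pos_homogeneous f" "pos_homogeneous g" and "c \<ge> 0"
    and "\<And>y. c * g y \<le> f y" and "f x = c * g x"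
    and "v \<in> subdifferential g x"
  shows "c *\<^sub>R v \<in> subdifferential f x"
proof -
  have "v \<bullet> x = g x" and v: "\<And>y. v \<bullet> y \<le> g y"
    using assms(2,6) by (auto simp: subdifferential_pos_homogeneous)
  moreover have "c * (v \<bullet> y) \<le> f y" for y
    using mult_left_mono[OF v assms(3)] assms(4) by (rule order_trans)
  ultimately show ?thesis
    using assms(1,5) by (simp add: subdifferential_pos_homogeneous)
qed

text \<open>
  A subgradient is obtained edge by edge from one of \<open>\<bar>x i - x j\<bar>\<close>; the factor \<open>1/2\<close>
  compensates for each edge being counted as two arcs.
\<close>

lemma laplacian1_nonempty: "laplacian1 E x \<noteq> {}"
proof -
  define v :: "real ^ 'a" where "v = (\<Sum>(i, j)\<in>arcs E. sgn (x $ i - x $ j) *\<^sub>R (axis i 1 - axis j 1)) /\<^sub>R 2"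
  have v: "v \<bullet> y = (\<Sum>(i, j)\<in>arcs E. sgn (x $ i - x $ j) * (y $ i - y $ j)) / 2" for y
    by (simp add: v_def inner_sum_left case_prod_unfold inner_diff_left inner_axis')
  have "v \<bullet> x = I_minus E x"
    by (simp add: v I_minus_eq_sum_arcs sgn_mult_self_eq abs_sgn mult.commute)
  moreover have "v \<bullet> y \<le> I_minus E y" for y
    unfolding v I_minus_eq_sum_arcs
    by (intro divide_right_mono sum_mono) (auto simp: sgn_if)
  ultimately show ?thesis
    unfolding laplacian1_def subdifferential_pos_homogeneous[OF pos_homogeneous_I_minus] by blast
qed

lemma DSgn_nonempty: "DSgn E x \<noteq> {}"
proof -
  have "(\<chi> i. real (deg E i) * sgn (x $ i)) \<in> DSgn E x"
    by (auto simp: DSgn_def Sgn_def sgn_if)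
  then show ?thesis by blast
qed

lemma DSgn_subset_subdifferential: "DSgn E x \<subseteq> subdifferential (wnorm E) x"
proof
  fix w assume w: "w \<in> DSgn E x"
  have "\<exists>s. w $ i = real (deg E i) * s \<and> s * x $ i = \<bar>x $ i\<bar> \<and> \<bar>s\<bar> \<le> 1" for i
  proof -
    obtain s where "w $ i = real (deg E i) * s" "s \<in> Sgn (x $ i)"
      using w by (auto simp: DSgn_def)
    then show ?thesis by (intro exI[of _ s]) (auto simp: Sgn_def split: if_splits)
  qed
  then obtain s where s: "\<And>i. w $ i = real (deg E i) * s i"
      "\<And>i. s i * x $ i = \<bar>x $ i\<bar>" "\<And>i. \<bar>s i\<bar> \<le> 1"
    by metis
  have "w \<bullet> x = wnorm E x"
    by (simp add: inner_vec_def wnorm_def s mult.assoc)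
  moreover have "w \<bullet> y \<le> wnorm E y" for y
  proof -
    have "s i * y $ i \<le> \<bar>y $ i\<bar>" for i
      using mult_right_mono[OF s(3)[of i] abs_ge_zero[of "y $ i"]]
      by (simp flip: abs_mult)
    then show ?thesis
      by (auto simp: inner_vec_def wnorm_def s(1) mult.assoc intro!: sum_mono mult_left_mono)
  qed
  ultimately show "w \<in> subdifferential (wnorm E) x"
    by (simp add: subdifferential_pos_homogeneous[OF pos_homogeneous_wnorm])
qed

section \<open>Eigenvalues and Rayleigh quotients\<close>

lemma signless_eigenpair_value:
  assumes "signless_eigenpair E \<mu> x"
  shows "\<mu> = I_plus E x / wnorm E x"
proof -
  obtain w where w: "w \<in> DSgn E x" "\<mu> *\<^sub>R w \<in> subdifferential (I_plus E) x" "wnorm E x = 1"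
    using assms by (auto simp: signless_eigenpair_def signless_laplacian1_def)
  then have "w \<bullet> x = wnorm E x"
    using DSgn_subset_subdifferential[of E x]
    by (auto simp: subdifferential_pos_homogeneous[OF pos_homogeneous_wnorm])
  with w show ?thesis
    by (simp add: subdifferential_pos_homogeneous[OF pos_homogeneous_I_plus])
qed

text \<open>
  Pairing the inclusion with \<open>x\<close> gives \<open>(1 - \<mu>) I_plus E x = \<mu> I_minus E x\<close>, which can be solved for
  \<open>\<mu>\<close> because the normalisation keeps the denominator away from \<open>0\<close>.
\<close>

lemma modified_signless_eigenpair_value:
  fixes E :: "'n::finite set set"
  assumes "simple_graph E" and "modified_signless_eigenpair E \<mu> x"
  shows "I_plus E x + I_minus E x \<noteq> 0" and "\<mu> = I_plus E x / (I_plus E x + I_minus E x)"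
proof -
  obtain u v where uv: "u \<in> subdifferential (I_plus E) x" "v \<in> subdifferential (I_minus E) x"
    "(1 - \<mu>) *\<^sub>R u = \<mu> *\<^sub>R v" and "wnorm E x = 1"
    using assms(2)
    by (auto simp: modified_signless_eigenpair_def signless_laplacian1_def laplacian1_def)
  then show pos: "I_plus E x + I_minus E x \<noteq> 0"
    using wnorm_le_I_plus_I_minus[OF assms(1), of x] by auto
  have "(1 - \<mu>) * (u \<bullet> x) = \<mu> * (v \<bullet> x)"
    using arg_cong[OF uv(3), of "\<lambda>w. w \<bullet> x"] by simp
  then have "(1 - \<mu>) * I_plus E x = \<mu> * I_minus E x"
    using uv by (simp add: subdifferential_pos_homogeneous pos_homogeneous_I_plus
        pos_homogeneous_I_minus)
  then show "\<mu> = I_plus E x / (I_plus E x + I_minus E x)"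
    using pos by (simp add: field_simps)
qed

lemma is_minimum_quotient_bound:
  assumes "is_minimum {N x / D x | x. x \<noteq> 0 \<and> D x \<noteq> 0} m"
    and "D 0 = 0" "\<And>x. N x \<ge> 0" "\<And>x. D x \<ge> 0"
  shows "m * D y \<le> (N y :: real)"
proof (cases "D y = 0")
  case False
  then have "D y > 0" "y \<noteq> 0" using assms(2,4) by (auto simp: less_le)
  moreover from this have "m \<le> N y / D y"
    using assms(1) unfolding is_minimum_def by fastforce
  ultimately show ?thesis by (simp add: pos_le_divide_eq)
qed (use assms in simp)

lemma signless_eigenvalue_minimum:
  assumes min: "is_minimum {I_plus E x / wnorm E x | x. x \<noteq> 0 \<and> wnorm E x \<noteq> 0} m"
  shows "is_minimum {\<mu>. signless_eigenvalue E \<mu>} m"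
proof -
  obtain x where x: "wnorm E x \<noteq> 0" "m = I_plus E x / wnorm E x"
    using min by (auto simp: is_minimum_def)
  define z where "z = x /\<^sub>R wnorm E x"
  have z: "wnorm E z = 1" "I_plus E z = m"
    using x wnorm_nonneg[of E x] pos_homogeneous_wnorm[of E] pos_homogeneous_I_plus[of E]
    by (simp_all add: z_def pos_homogeneous_def divide_inverse mult.commute)
  obtain w where w: "w \<in> DSgn E z" using DSgn_nonempty by blast
  have "m *\<^sub>R w \<in> subdifferential (I_plus E) z"
  proof (rule scaled_subgradient_at_minimiser)
    show "w \<in> subdifferential (wnorm E) z" using w DSgn_subset_subdifferential by blast
    show "m \<ge> 0" using x(2) by (simp add: I_plus_nonneg wnorm_nonneg)
    show "m * wnorm E y \<le> I_plus E y" for y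
      by (rule is_minimum_quotient_bound[OF min])
         (simp_all add: I_plus_nonneg wnorm_nonneg pos_homogeneous_zero pos_homogeneous_wnorm)
  qed (simp_all add: z pos_homogeneous_I_plus pos_homogeneous_wnorm)
  with w z(1) have "signless_eigenpair E m z"
    by (auto simp: signless_eigenpair_def signless_laplacian1_def)
  moreover have "m \<le> \<mu>" if "signless_eigenpair E \<mu> y" for \<mu> y
  proof -
    have "wnorm E y = 1" using that by (simp add: signless_eigenpair_def)
    moreover from this have "y \<noteq> 0"
      by (auto simp: pos_homogeneous_zero pos_homogeneous_wnorm)
    ultimately show ?thesis
      using min signless_eigenpair_value[OF that] unfolding is_minimum_def by fastforce
  qed
  ultimately show ?thesis
    unfolding is_minimum_def signless_eigenvalue_def by blast
qed

lemma modified_signless_eigenvalue_minimum: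
  fixes E :: "'n::finite set set"
  assumes "simple_graph E" and "E \<noteq> {}"
    and min: "is_minimum {I_plus E x / (I_plus E x + I_minus E x) | x.
      x \<noteq> 0 \<and> I_plus E x + I_minus E x \<noteq> 0} m"
  shows "is_minimum {\<mu>. modified_signless_eigenvalue E \<mu>} m"
proof -
  let ?D = "\<lambda>x. I_plus E x + I_minus E x"
  have hom: "I_plus E 0 = 0" "I_minus E 0 = 0" "wnorm E 0 = 0"
    by (simp_all add: pos_homogeneous_zero pos_homogeneous_I_plus pos_homogeneous_I_minus
        pos_homogeneous_wnorm)
  have bound: "m * ?D y \<le> I_plus E y" for y
    by (rule is_minimum_quotient_bound[OF min]) (simp_all add: I_plus_nonneg I_minus_nonneg hom)
  obtain x where x: "?D x \<noteq> 0" "m = I_plus E x / ?D x"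
    using min by (auto simp: is_minimum_def)
  have "m \<ge> 0" using x(2) by (simp add: I_plus_nonneg I_minus_nonneg)
  \<comment> \<open>The bound for the indicator vector of an endpoint of an edge, where \<open>I_minus\<close> is
     positive, rules out \<open>m \<ge> 1\<close>.\<close>
  have "m < 1"
  proof -
    obtain e where e: "e \<in> E" using assms(2) by blast
    then have "card e = 2" using assms(1) by (simp add: simple_graph_def)
    with e obtain i j where "{i, j} \<in> E" by (auto simp: card_2_iff)
    then have pos: "I_minus E (axis i 1) > 0" using I_minus_axis_pos[OF assms(1)] by blast
    show ?thesis
    proof (rule ccontr)
      assume "\<not> m < 1"
      then have "1 * ?D (axis i 1) \<le> m * ?D (axis i 1)"
        by (intro mult_right_mono) (simp_all add: I_plus_nonneg I_minus_nonneg)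
      with bound[of "axis i 1"] pos show False by simp
    qed
  qed
  \<comment> \<open>The minimiser is only known to have a nonzero denominator; it must also be normalisable.\<close>
  have "wnorm E x \<noteq> 0"
    using I_plus_I_minus_le_wnorm[OF assms(1), of x] x(1) I_plus_nonneg[of E x] I_minus_nonneg[of E x]
    by auto
  define z where "z = x /\<^sub>R wnorm E x"
  have z: "wnorm E z = 1"
    using \<open>wnorm E x \<noteq> 0\<close> wnorm_nonneg[of E x] pos_homogeneous_wnorm[of E]
    by (simp add: z_def pos_homogeneous_def)
  have "(1 - m) * I_plus E x = m * I_minus E x"
    using x by (simp add: field_simps)
  then have "(1 - m) * I_plus E z = m * I_minus E z"
    using wnorm_nonneg[of E x] pos_homogeneous_I_plus[of E] pos_homogeneous_I_minus[of E]
    by (simp add: z_def pos_homogeneous_def)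
  \<comment> \<open>The bound \<open>m * (I_plus + I_minus) \<le> I_plus\<close>, tight at \<open>z\<close>, is solved for \<open>I_plus\<close>.\<close>
  then have z_eq: "I_plus E z = m / (1 - m) * I_minus E z"
    using \<open>m < 1\<close> by (simp add: field_simps)
  obtain v where v: "v \<in> laplacian1 E z" using laplacian1_nonempty by blast
  have "(m / (1 - m)) *\<^sub>R v \<in> subdifferential (I_plus E) z"
  proof (rule scaled_subgradient_at_minimiser)
    show "v \<in> subdifferential (I_minus E) z" using v by (simp add: laplacian1_def)
    show "m / (1 - m) \<ge> 0" using \<open>m \<ge> 0\<close> \<open>m < 1\<close> by simp
    show "m / (1 - m) * I_minus E y \<le> I_plus E y" for y
      using bound[of y] \<open>m < 1\<close> by (simp add: field_simps)
  qed (use z_eq in \<open>simp_all add: pos_homogeneous_I_plus pos_homogeneous_I_minus\<close>)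
  moreover have "(1 - m) *\<^sub>R ((m / (1 - m)) *\<^sub>R v) = m *\<^sub>R v" using \<open>m < 1\<close> by simp
  ultimately have "modified_signless_eigenpair E m z"
    unfolding modified_signless_eigenpair_def signless_laplacian1_def using v z
    by (metis (no_types, lifting) IntI empty_iff image_eqI)
  moreover have "m \<le> \<mu>" if "modified_signless_eigenpair E \<mu> y" for \<mu> y
  proof -
    have "y \<noteq> 0" using that hom by (auto simp: modified_signless_eigenpair_def)
    then show ?thesis
      using min modified_signless_eigenpair_value[OF assms(1) that]
      unfolding is_minimum_def by fastforce
  qed
  ultimately show ?thesis
    unfolding is_minimum_def modified_signless_eigenvalue_def by blast
qed

theorem theorem1p2:
  fixes E :: "'n::finite set set"
  assumes "simple_graph E" and "E \<noteq> {}"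
  shows "(\<exists>\<mu>1. is_minimum {\<mu>. signless_eigenvalue E \<mu>} \<mu>1 \<and>
            1 - dual_cheeger E = \<mu>1 \<and>
            is_minimum {I_plus E x / wnorm E x | x. x \<noteq> 0 \<and> wnorm E x \<noteq> 0} \<mu>1) \<and>
         (\<exists>\<mu>1. is_minimum {\<mu>. modified_signless_eigenvalue E \<mu>} \<mu>1 \<and>
            1 - modified_dual_cheeger E = \<mu>1 \<and>
            is_minimum {I_plus E x / (I_plus E x + I_minus E x) | x.
                          x \<noteq> 0 \<and> I_plus E x + I_minus E x \<noteq> 0} \<mu>1)"
proof -
  let ?D = "\<lambda>x. I_plus E x + I_minus E x"
  have zero: "I_plus E 0 = 0" "I_minus E 0 = 0" "wnorm E 0 = 0"
    by (simp_all add: pos_homogeneous_zero pos_homogeneous_I_plus pos_homogeneous_I_minus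
        pos_homogeneous_wnorm)
  obtain e where e: "e \<in> E" using assms(2) by blast
  then have "card e = 2" using assms(1) by (simp add: simple_graph_def)
  with e obtain i where "i \<in> e" by (auto simp: card_2_iff)
  with e have "deg E i \<noteq> 0" by (auto simp: deg_def)
  then have "vol E UNIV \<noteq> 0" by (auto simp: vol_def)
  then have nontrivial: "wnorm E (sign_vec UNIV {}) > 0" by (simp add: wnorm_sign_vec)

  have min: "is_minimum {I_plus E x / wnorm E x | x. x \<noteq> 0 \<and> wnorm E x \<noteq> 0} (1 - dual_cheeger E)"
  proof -
    have "dual_cheeger E =
      Max {2 * real (card (edges_between E V1 V2)) / real (vol E (V1 \<union> V2)) | V1 V2.
        V1 \<inter> V2 = {} \<and> V1 \<union> V2 \<noteq> {} \<and> wnorm E (sign_vec V1 V2) \<noteq> 0}"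
      unfolding dual_cheeger_def
      by (intro arg_cong[where f = Max] Collect_cong) (metis wnorm_sign_vec of_nat_eq_0_iff)
    also have "is_minimum {I_plus E x / wnorm E x | x. x \<noteq> 0 \<and> wnorm E x \<noteq> 0} (1 - \<dots>)"
      by (rule is_minimum_quotient_of_cheeger)
         (use nontrivial in \<open>auto simp: layer_additive_I_plus layer_additive_wnorm zero
            I_plus_nonneg wnorm_nonneg I_plus_sign_vec[OF assms(1)] wnorm_sign_vec field_simps\<close>)
    finally show ?thesis .
  qed
  have modified_min: "is_minimum {I_plus E x / ?D x | x. x \<noteq> 0 \<and> ?D x \<noteq> 0}
    (1 - modified_dual_cheeger E)"
  proof -
    have nontrivial': "?D (sign_vec UNIV {}) \<noteq> 0"
      using nontrivial wnorm_le_I_plus_I_minus[OF assms(1), of "sign_vec UNIV {}"] by simp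
    let ?b = "\<lambda>V1 V2. real (card (edges_between E (V1 \<union> V2) (- (V1 \<union> V2))))"
    have "modified_dual_cheeger E =
      Max {(2 * real (card (edges_between E V1 V2)) + ?b V1 V2)
          / (real (vol E (V1 \<union> V2)) + ?b V1 V2) | V1 V2.
        V1 \<inter> V2 = {} \<and> V1 \<union> V2 \<noteq> {} \<and> ?D (sign_vec V1 V2) \<noteq> 0}"
      unfolding modified_dual_cheeger_def
      by (intro arg_cong[where f = Max] Collect_cong) (metis I_plus_I_minus_sign_vec[OF assms(1)])
    also have "is_minimum {I_plus E x / ?D x | x. x \<noteq> 0 \<and> ?D x \<noteq> 0} (1 - \<dots>)"
    proof (rule is_minimum_quotient_of_cheeger)
      show "(2 * real (card (edges_between E V1 V2)) + ?b V1 V2)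
          / (real (vol E (V1 \<union> V2)) + ?b V1 V2)
          = 1 - I_plus E (sign_vec V1 V2) / ?D (sign_vec V1 V2)"
        if "V1 \<inter> V2 = {}" "?D (sign_vec V1 V2) \<noteq> 0" for V1 V2
        using that(2) unfolding I_plus_I_minus_sign_vec[OF assms(1) that(1)]
        unfolding I_plus_sign_vec[OF assms(1) that(1)] by (simp add: field_simps)
    qed (use nontrivial' in \<open>auto simp: layer_additive_I_plus layer_additive_I_minus
          layer_additive_add zero I_plus_nonneg I_minus_nonneg\<close>)
    finally show ?thesis .
  qed
  show ?thesis
    using signless_eigenvalue_minimum[OF min] min
      modified_signless_eigenvalue_minimum[OF assms modified_min] modified_min
    by blast
qed

end
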